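(* Let $x^\star\in X$. If $x^\star$ is a global minimizer of $F=g-f$ over $X$, then $\partial_\Phi^\varepsilon f(x^\star)\subseteq\partial_\Phi^\varepsilon g(x^\star)$ for all $\varepsilon>0$. Conversely, $\partial_\Phi^\varepsilon f(x^\star)\subseteq\partial_\Phi^\varepsilon g(x^\star)$ for all $\varepsilon\ge0$ implies that $x^\star$ is a global minimizer of $F$ over $X$.
   Context: Setting. $X\subseteq\mathbb{R}^n$ and $Y\subseteq\mathbb{R}^m$ are nonempty and $\Phi:X\times Y\to\mathbb{R}$ is jointly continuous relative to $X\times Y$. $\overline{\mathbb{R}}=\mathbb{R}\cup\{\pm\infty\}$. A function is proper if it never takes the value $-\infty$ and is not identically $+\infty$. A function $f:X\to\overline{\mathbb{R}}$ is $\Phi$-convex if there are an index set $I$ and $(y_i,\beta_i)\in Y\times\overline{\mathbb{R}}$, $i\in I$, with $f(x)=\sup_{i\in I}\Phi(x,y_i)-\beta_i$ for all $x\in X$ (and $f\equiv-\infty$ if $I=\emptyset$). Standing assumptions: $f:X\to\overline{\mathbb{R}}$ is proper and $\Phi$-convex; $g:X\to\overline{\mathbb{R}}$ is proper and lower semicontinuous relative to $X$, and there exist $y\in Y$, $\beta\in\mathbb{R}$ with $g\ge\Phi(\cdot,y)-\beta$ on $X$; $F:=g-f$ (with the convention $g(x)-f(x)=+\infty$ if both values are $+\infty$) satisfies $-\infty<\inf_X F<\infty$. $\varepsilon$-$\Phi$-subdifferential: for $\varphi:X\to\overline{\mathbb{R}}$, $\varepsilon\ge0$ and $\bar x\in X$,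 $\partial_\Phi^\varepsilon\varphi(\bar x)$ is the set of all $y\in Y$ such that $\varphi(x)\ge\varphi(\bar x)+\Phi(x,y)-\Phi(\bar x,y)-\varepsilon$ for all $x\in X$.
   Formalization: The converse is stated only for points with f(x* ) < +∞; where f(x* ) = +∞ the ε-Φ-subdifferential of f is empty, so the inclusions hold vacuously although x* is never a minimizer of F. *)

theory Defs
  imports "HOL-Analysis.Analysis"
begin

text \<open>
  A function from \<open>X\<close> to the extended reals is represented by a total function; all notions
  below depend only on its values on \<open>X\<close>.
\<close>

definition proper_on :: "'a set \<Rightarrow> ('a \<Rightarrow> ereal) \<Rightarrow> bool" where
  "proper_on X \<phi> \<longleftrightarrow> (\<forall>x\<in>X. \<phi> x \<noteq> -\<infinity>) \<and> (\<exists>x\<in>X. \<phi> x \<noteq> \<infinity>)"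

definition lsc_on :: "'a::topological_space set \<Rightarrow> ('a \<Rightarrow> ereal) \<Rightarrow> bool" where
  "lsc_on X \<phi> \<longleftrightarrow> (\<forall>x\<in>X. \<phi> x \<le> Liminf (at x within X) \<phi>)"

text \<open>
  The index set is represented by the set \<open>P\<close> of all pairs \<open>(y\<^sub>i, \<beta>\<^sub>i)\<close>; lemma \<open>phi_convexI\<close> shows
  that this covers families over an arbitrary index type.  The supremum of the empty set
  is \<open>-\<infinity>\<close> in type \<^typ>\<open>ereal\<close>.
\<close>

definition phi_convex ::
    "'a set \<Rightarrow> 'b set \<Rightarrow> ('a \<Rightarrow> 'b \<Rightarrow> real) \<Rightarrow> ('a \<Rightarrow> ereal) \<Rightarrow> bool" where
  "phi_convex X Y \<Phi> f \<longleftrightarrow>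
     (\<exists>P \<subseteq> Y \<times> (UNIV :: ereal set). \<forall>x\<in>X. f x = (SUP (y, \<beta>)\<in>P. ereal (\<Phi> x y) - \<beta>))"

lemma phi_convexI:
  fixes I :: "'i set" and y :: "'i \<Rightarrow> 'b" and \<beta> :: "'i \<Rightarrow> ereal"
  assumes "\<And>i. i \<in> I \<Longrightarrow> y i \<in> Y"
    and "\<And>x. x \<in> X \<Longrightarrow> f x = (SUP i\<in>I. ereal (\<Phi> x (y i)) - \<beta> i)"
  shows "phi_convex X Y \<Phi> f"
  unfolding phi_convex_def
  by (rule exI[of _ "(\<lambda>i. (y i, \<beta> i)) ` I"]) (use assms in \<open>auto simp: image_image\<close>)

text \<open>
  For proper \<open>\<phi>\<close> this set is empty whenever \<open>\<phi> xb = \<infinity>\<close>.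
\<close>

definition phi_subdiff ::
    "'a set \<Rightarrow> 'b set \<Rightarrow> ('a \<Rightarrow> 'b \<Rightarrow> real) \<Rightarrow> real \<Rightarrow> ('a \<Rightarrow> ereal) \<Rightarrow> 'a \<Rightarrow> 'b set" where
  "phi_subdiff X Y \<Phi> \<epsilon> \<phi> xb =
     {y \<in> Y. \<forall>x\<in>X. \<phi> x \<ge> \<phi> xb + ereal (\<Phi> x y) - ereal (\<Phi> xb y) - ereal \<epsilon>}"

text \<open>
  The convention \<open>g x - f x = +\<infinity>\<close> when both values are \<open>+\<infinity>\<close> is that of \<^typ>\<open>ereal\<close>.
\<close>

lemma ereal_infinity_minus_infinity: "(\<infinity> :: ereal) - \<infinity> = \<infinity>"
  by simp

end

theory Submission
  imports Defs
begin

text \<open>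
  Where \<open>f\<close> and \<open>g\<close> are finite at \<open>x\<^sup>\<star>\<close>, minimality of \<open>x\<^sup>\<star>\<close> for \<open>g - f\<close> says that \<open>g\<close> grows at least
  as much as \<open>f\<close> when moving away from \<open>x\<^sup>\<star>\<close>: \<open>f x - f x\<^sup>\<star> \<le> g x - g x\<^sup>\<star>\<close> for all \<open>x\<close>
  (\<open>is_arg_min_diff_iff\<close>).  A subgradient inequality bounds precisely such an increment from
  below, so every \<open>\<epsilon>\<close>-subgradient of \<open>f\<close> is then one of \<open>g\<close> (\<open>phi_subdiff_mono\<close>).

  Conversely, \<open>f\<close> is a supremum of elementary functions \<open>\<Phi> _ y - \<beta>\<close>.  For each of them,
  \<open>y\<close> is an \<open>\<epsilon>\<close>-subgradient of \<open>f\<close> at \<open>x\<^sup>\<star>\<close> when \<open>\<epsilon>\<close> is the gap to \<open>f\<close> there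
  (\<open>minorant_mem_phi_subdiff\<close>).  If \<open>y\<close> is also an \<open>\<epsilon>\<close>-subgradient of \<open>g\<close> with the same \<open>\<epsilon>\<close>, the
  value \<open>\<Phi> x\<^sup>\<star> y\<close> cancels and \<open>\<Phi> x y - \<beta> \<le> g x - g x\<^sup>\<star> + f x\<^sup>\<star>\<close>; the supremum over all \<open>(y, \<beta>)\<close>
  is the increment inequality (\<open>increments_le_if_phi_subdiff_subset\<close>).

  A proper function has no \<open>\<epsilon>\<close>-subgradient where it takes the value \<open>\<infinity>\<close>
  (\<open>phi_subdiff_infinite_value\<close>).  So if \<open>f x\<^sup>\<star> = \<infinity>\<close>, the inclusions hold trivially and carry no
  information about \<open>g\<close>, which is why the converse asks for \<open>f x\<^sup>\<star> < \<infinity>\<close>; and if \<open>f x\<^sup>\<star>\<close> is finite, they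
  force \<open>g x\<^sup>\<star>\<close> to be finite.  At other points, \<open>g - f\<close> being bounded below forces \<open>g = \<infinity>\<close> wherever
  \<open>f = \<infinity>\<close>.
\<close>

lemma phi_subdiff_infinite_value:
  assumes "proper_on X \<phi>" and "\<phi> xb = \<infinity>"
  shows "phi_subdiff X Y \<Phi> \<epsilon> \<phi> xb = {}"
  using assms by (auto simp: phi_subdiff_def proper_on_def)

lemma is_arg_min_diff_iff:
  fixes f g :: "'a \<Rightarrow> ereal"
  assumes "xb \<in> X" and "f xb = ereal a" and "g xb = ereal b"
    and "\<And>x. x \<in> X \<Longrightarrow> f x \<noteq> -\<infinity>" and "\<And>x. x \<in> X \<Longrightarrow> g x - f x \<noteq> -\<infinity>"
  shows "is_arg_min (\<lambda>x. g x - f x) (\<lambda>x. x \<in> X) xb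
    \<longleftrightarrow> (\<forall>x\<in>X. f x - ereal a \<le> g x - ereal b)"
proof -
  have "g xb - f xb \<le> g x - f x \<longleftrightarrow> f x - ereal a \<le> g x - ereal b" if "x \<in> X" for x
    using assms(2,3) assms(4,5)[OF that]
    by (cases "f x"; cases "g x") auto
  with \<open>xb \<in> X\<close> show ?thesis
    by (auto simp: is_arg_min_def not_less)
qed

lemma phi_subdiff_mono:
  fixes f g :: "'a \<Rightarrow> ereal"
  assumes "f xb = ereal a" and "g xb = ereal b"
    and "\<And>x. x \<in> X \<Longrightarrow> f x - ereal a \<le> g x - ereal b"
  shows "phi_subdiff X Y \<Phi> \<epsilon> f xb \<subseteq> phi_subdiff X Y \<Phi> \<epsilon> g xb"
proof
  fix y assume y: "y \<in> phi_subdiff X Y \<Phi> \<epsilon> f xb"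
  have "g xb + ereal (\<Phi> x y) - ereal (\<Phi> xb y) - ereal \<epsilon> \<le> g x" if "x \<in> X" for x
  proof -
    have "f xb + ereal (\<Phi> x y) - ereal (\<Phi> xb y) - ereal \<epsilon> \<le> f x"
      using y that by (auto simp: phi_subdiff_def)
    with assms(1,2) assms(3)[OF that] show ?thesis
      by (cases "f x"; cases "g x") auto
  qed
  with y show "y \<in> phi_subdiff X Y \<Phi> \<epsilon> g xb"
    by (auto simp: phi_subdiff_def)
qed

text \<open>
  The value of \<open>\<epsilon>\<close> is the gap at \<open>xb\<close> between \<open>f\<close> and its minorant, chosen so that the subgradient
  inequality turns into the minorant inequality.
\<close>

lemma minorant_mem_phi_subdiff:
  assumes "y \<in> Y" and "f xb = ereal a"
    and "\<And>x. x \<in> X \<Longrightarrow> ereal (\<Phi> x y - \<beta>) \<le> f x"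
  shows "y \<in> phi_subdiff X Y \<Phi> (a - (\<Phi> xb y - \<beta>)) f xb"
  using assms by (auto simp: phi_subdiff_def algebra_simps)

text \<open>
  The pairs with \<open>\<beta> = \<infinity>\<close> contribute only \<open>-\<infinity>\<close> to the supremum, and one pair with \<open>\<beta> = -\<infinity>\<close> would
  make \<open>f\<close> identically \<open>\<infinity>\<close> on \<open>X\<close>.
\<close>

lemma phi_convex_real_offsets:
  fixes f :: "'a \<Rightarrow> ereal"
  assumes "phi_convex X Y \<Phi> f" and "xb \<in> X" and "f xb = ereal a"
  obtains Q :: "('b \<times> real) set"
  where "Q \<subseteq> Y \<times> UNIV" and "Q \<noteq> {}"
    and "\<And>x. x \<in> X \<Longrightarrow> f x = (SUP (y, \<beta>)\<in>Q. ereal (\<Phi> x y - \<beta>))"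
proof -
  obtain P where "P \<subseteq> Y \<times> UNIV"
    and f_eq: "\<And>x. x \<in> X \<Longrightarrow> f x = (SUP (y, \<beta>)\<in>P. ereal (\<Phi> x y) - \<beta>)"
    using \<open>phi_convex X Y \<Phi> f\<close> by (auto simp: phi_convex_def)
  define Q where "Q = {(y, \<beta>). (y, ereal \<beta>) \<in> P}"
  have no_MInf: "\<beta> \<noteq> -\<infinity>" if "(y, \<beta>) \<in> P" for y \<beta>
  proof
    assume "\<beta> = -\<infinity>"
    have "ereal (\<Phi> xb y) - \<beta> \<le> f xb"
      using that \<open>xb \<in> X\<close> by (auto simp: f_eq intro: SUP_upper2)
    with \<open>\<beta> = -\<infinity>\<close> \<open>f xb = ereal a\<close> show False by simp
  qed
  have eq: "f x = (SUP (y, \<beta>)\<in>Q. ereal (\<Phi> x y - \<beta>))" if "x \<in> X" for x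
  proof (rule antisym)
    have "ereal (\<Phi> x y) - \<beta> \<le> (SUP (y, \<beta>)\<in>Q. ereal (\<Phi> x y - \<beta>))"
      if "(y, \<beta>) \<in> P" for y \<beta>
      using that no_MInf[OF that]
      by (cases \<beta>) (auto simp: Q_def intro!: SUP_upper2[where i = "(y, real_of_ereal \<beta>)"])
    then show "f x \<le> (SUP (y, \<beta>)\<in>Q. ereal (\<Phi> x y - \<beta>))"
      using \<open>x \<in> X\<close> by (auto simp: f_eq intro!: SUP_least)
    have "ereal (\<Phi> x y - \<beta>) \<le> f x" if "(y, \<beta>) \<in> Q" for y \<beta>
      using that \<open>x \<in> X\<close>
      by (auto simp: f_eq Q_def intro!: SUP_upper2[where i = "(y, ereal \<beta>)"])
    then show "(SUP (y, \<beta>)\<in>Q. ereal (\<Phi> x y - \<beta>)) \<le> f x"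
      by (auto intro!: SUP_least)
  qed
  moreover have "Q \<noteq> {}"
    using eq[OF \<open>xb \<in> X\<close>] \<open>f xb = ereal a\<close> by (auto simp: bot_ereal_def)
  moreover have "Q \<subseteq> Y \<times> UNIV"
    using \<open>P \<subseteq> Y \<times> UNIV\<close> by (auto simp: Q_def)
  ultimately show thesis using that by blast
qed

text \<open>
  Finiteness of \<open>g xb\<close> comes with the inclusions: since \<open>f\<close> has some \<open>\<epsilon>\<close>-subgradient at \<open>xb\<close>,
  so has \<open>g\<close>.
\<close>

lemma increments_le_if_phi_subdiff_subset:
  fixes f g :: "'a \<Rightarrow> ereal"
  assumes "phi_convex X Y \<Phi> f" and "proper_on X g"
    and "xb \<in> X" and "f xb = ereal a"
    and subset: "\<And>\<epsilon>. \<epsilon> \<ge> 0 \<Longrightarrow> phi_subdiff X Y \<Phi> \<epsilon> f xb \<subseteq> phi_subdiff X Y \<Phi> \<epsilon> g xb"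
  obtains b where "g xb = ereal b" and "\<And>x. x \<in> X \<Longrightarrow> f x - ereal a \<le> g x - ereal b"
proof -
  obtain Q where "Q \<subseteq> Y \<times> UNIV" and "Q \<noteq> {}"
    and f_eq: "\<And>x. x \<in> X \<Longrightarrow> f x = (SUP (y, \<beta>)\<in>Q. ereal (\<Phi> x y - \<beta>))"
    using phi_convex_real_offsets[OF \<open>phi_convex X Y \<Phi> f\<close> \<open>xb \<in> X\<close> \<open>f xb = ereal a\<close>] by metis
  have g_subgradient: "y \<in> phi_subdiff X Y \<Phi> (a - (\<Phi> xb y - \<beta>)) g xb" if "(y, \<beta>) \<in> Q" for y \<beta>
  proof -
    have minorant: "ereal (\<Phi> x y - \<beta>) \<le> f x" if "x \<in> X" for x
      using \<open>(y, \<beta>) \<in> Q\<close> that by (auto simp: f_eq intro!: SUP_upper2[where i = "(y, \<beta>)"])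
    have "y \<in> phi_subdiff X Y \<Phi> (a - (\<Phi> xb y - \<beta>)) f xb"
      using \<open>Q \<subseteq> Y \<times> UNIV\<close> that minorant \<open>f xb = ereal a\<close>
      by (intro minorant_mem_phi_subdiff) auto
    moreover have "a - (\<Phi> xb y - \<beta>) \<ge> 0"
      using minorant[OF \<open>xb \<in> X\<close>] \<open>f xb = ereal a\<close> by simp
    ultimately show ?thesis using subset by blast
  qed
  have "g xb \<noteq> \<infinity>"
    using \<open>Q \<noteq> {}\<close> g_subgradient phi_subdiff_infinite_value[OF \<open>proper_on X g\<close>] by fastforce
  moreover have "g xb \<noteq> -\<infinity>"
    using \<open>proper_on X g\<close> \<open>xb \<in> X\<close> by (auto simp: proper_on_def)
  ultimately obtain b where b: "g xb = ereal b"
    by (cases "g xb") auto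
  moreover have "f x - ereal a \<le> g x - ereal b" if "x \<in> X" for x
  proof -
    have "ereal (\<Phi> x y - \<beta>) \<le> g x + ereal (a - b)" if "(y, \<beta>) \<in> Q" for y \<beta>
    proof -
      have "g xb + ereal (\<Phi> x y) - ereal (\<Phi> xb y) - ereal (a - (\<Phi> xb y - \<beta>)) \<le> g x"
        using g_subgradient[OF that] \<open>x \<in> X\<close> by (auto simp: phi_subdiff_def)
      with b show ?thesis by (cases "g x") auto
    qed
    then have "f x \<le> g x + ereal (a - b)"
      using \<open>x \<in> X\<close> by (auto simp: f_eq intro!: SUP_least)
    then show ?thesis by (cases "f x"; cases "g x") auto
  qed
  ultimately show thesis using that by blast
qed

theorem proposition3p2:
  fixes X :: "(real ^ 'n) set" and Y :: "(real ^ 'm) set"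
    and \<Phi> :: "real ^ 'n \<Rightarrow> real ^ 'm \<Rightarrow> real"
    and f g :: "real ^ 'n \<Rightarrow> ereal"
    and xs :: "real ^ 'n"
  assumes "X \<noteq> {}" and "Y \<noteq> {}"
    and "continuous_on (X \<times> Y) (\<lambda>(x, y). \<Phi> x y)"
    and "proper_on X f" and "phi_convex X Y \<Phi> f"
    and "proper_on X g" and "lsc_on X g"
    and "\<exists>y\<in>Y. \<exists>\<beta>::real. \<forall>x\<in>X. g x \<ge> ereal (\<Phi> x y - \<beta>)"
    and "-\<infinity> < (INF x\<in>X. g x - f x)" and "(INF x\<in>X. g x - f x) < \<infinity>"
    and "xs \<in> X"
  shows "(is_arg_min (\<lambda>x. g x - f x) (\<lambda>x. x \<in> X) xs \<longrightarrow>
            (\<forall>\<epsilon>>0. phi_subdiff X Y \<Phi> \<epsilon> f xs \<subseteq> phi_subdiff X Y \<Phi> \<epsilon> g xs)) \<and>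
         (f xs < \<infinity> \<longrightarrow>
            (\<forall>\<epsilon>\<ge>0. phi_subdiff X Y \<Phi> \<epsilon> f xs \<subseteq> phi_subdiff X Y \<Phi> \<epsilon> g xs) \<longrightarrow>
            is_arg_min (\<lambda>x. g x - f x) (\<lambda>x. x \<in> X) xs)"
proof -
  let ?min = "is_arg_min (\<lambda>x. g x - f x) (\<lambda>x. x \<in> X) xs"
  let ?sub = "\<lambda>\<epsilon>. phi_subdiff X Y \<Phi> \<epsilon> f xs \<subseteq> phi_subdiff X Y \<Phi> \<epsilon> g xs"
  have f_proper: "f x \<noteq> -\<infinity>" if "x \<in> X" for x
    using \<open>proper_on X f\<close> that by (auto simp: proper_on_def)
  have g_proper: "g x \<noteq> -\<infinity>" if "x \<in> X" for x
    using \<open>proper_on X g\<close> that by (auto simp: proper_on_def)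
  have diff: "g x - f x \<noteq> -\<infinity>" if "x \<in> X" for x
    using \<open>-\<infinity> < (INF x\<in>X. g x - f x)\<close> INF_lower[OF that, of "\<lambda>x. g x - f x"] by auto
  have "?sub \<epsilon>" if ?min for \<epsilon>
  proof (cases "f xs")
    case (real a)
    \<comment> \<open>The minimal value of \<open>g - f\<close> is finite, and hence so is \<open>g xs\<close>.\<close>
    obtain z where "z \<in> X" "g z - f z < \<infinity>"
      using \<open>(INF x\<in>X. g x - f x) < \<infinity>\<close> by (auto simp only: INF_less_iff)
    with \<open>?min\<close> have "g xs - f xs < \<infinity>"
      unfolding is_arg_min_def by (metis not_less order.strict_trans1)
    then obtain b where "g xs = ereal b"
      using real g_proper[OF \<open>xs \<in> X\<close>] by (cases "g xs") auto
    with real show ?thesis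
      using \<open>?min\<close> is_arg_min_diff_iff[of xs X f a g b] \<open>xs \<in> X\<close> f_proper diff
      by (intro phi_subdiff_mono) auto
  next
    case PInf
    show ?thesis
      by (simp add: phi_subdiff_infinite_value[OF \<open>proper_on X f\<close> PInf])
  qed (use f_proper \<open>xs \<in> X\<close> in auto)
  moreover have ?min if "f xs < \<infinity>" and sub: "\<forall>\<epsilon>\<ge>0. ?sub \<epsilon>"
  proof -
    obtain a where a: "f xs = ereal a"
      using \<open>f xs < \<infinity>\<close> f_proper[OF \<open>xs \<in> X\<close>] by (cases "f xs") auto
    obtain b where "g xs = ereal b" and "\<And>x. x \<in> X \<Longrightarrow> f x - ereal a \<le> g x - ereal b"
      using increments_le_if_phi_subdiff_subset
        [OF \<open>phi_convex X Y \<Phi> f\<close> \<open>proper_on X g\<close> \<open>xs \<in> X\<close> a] sub by metis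
    with a show ?thesis
      using is_arg_min_diff_iff[of xs X f a g b] \<open>xs \<in> X\<close> f_proper diff by auto
  qed
  ultimately show ?thesis by blast
qed

end
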